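(* Let $P, A, B, C$ be points in the Euclidean plane, let $r>0$ and let $Z=\{Q:|PQ|\le r\}$. Let $P^*\in Z$ be a solution of the Max-Min-Angle problem, i.e. a point of $Z$ maximizing, over $Q\in Z$, the smallest of the angles $\angle AQB,\angle BQC,\angle CQA$ (non-reflex angles in $[0,\pi]$). Suppose there are exactly two smallest angles around $P^*$, i.e. among the three angles between consecutive rays $P^*A,P^*B,P^*C$ (in counterclockwise order), two are equal and strictly smaller than the third. Then $P^*$ can be computed by solving a polynomial equation of degree at most four; that is, the coordinates of $P^*$ can be obtained from the coordinates of $P,A,B,C$ and from $r$ by finitely many field operations, square roots, and taking a root of a polynomial of degree at most four.
   Context: This is the Max-Min-Angle problem for a graph vertex of degree three: $P$ is the current position of the vertex, $A,B,C$ the positions of its neighbours, and the vertex may be moved to any point at distance at most $r$ from $P$, the aim being to maximize the smallest angle between incident edges.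
   Formalization: The points A, B, C are assumed pairwise distinct (if A = B every point of Z is a maximizer and the claim can fail), and the maximization is over points Q of Z other than A, B, C, with P* also different from them, since the angles are undefined there. *)

theory Defs
  imports "HOL-Analysis.Analysis" "HOL-Computational_Algebra.Polynomial"
begin

text \<open>Non-reflex angle XQY in [0,pi] (only meaningful for Q different from X and Y).\<close>
definition vertex_angle :: "complex \<Rightarrow> complex \<Rightarrow> complex \<Rightarrow> real" where
  "vertex_angle X Q Y = arccos (((X - Q) \<bullet> (Y - Q)) / (norm (X - Q) * norm (Y - Q)))"

definition min_angle :: "complex \<Rightarrow> complex \<Rightarrow> complex \<Rightarrow> complex \<Rightarrow> real" where
  "min_angle Q A B C = min (vertex_angle A Q B) (min (vertex_angle B Q C) (vertex_angle C Q A))"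

definition ccw_angle :: "complex \<Rightarrow> complex \<Rightarrow> complex \<Rightarrow> real" where
  "ccw_angle Q X Y = (let t = Arg ((Y - Q) / (X - Q)) in if t < 0 then t + 2 * pi else t)"

text \<open>The three angles between consecutive rays QA, QB, QC in counterclockwise order
  (they sum to 2 pi): either the cyclic order is A,B,C or it is A,C,B.\<close>
definition consecutive_angles :: "complex \<Rightarrow> complex \<Rightarrow> complex \<Rightarrow> complex \<Rightarrow> real \<times> real \<times> real" where
  "consecutive_angles Q A B C =
     (if ccw_angle Q A B + ccw_angle Q B C + ccw_angle Q C A = 2 * pi
      then (ccw_angle Q A B, ccw_angle Q B C, ccw_angle Q C A)
      else (ccw_angle Q A C, ccw_angle Q C B, ccw_angle Q B A))"

fun exactly_two_smallest :: "real \<times> real \<times> real \<Rightarrow> bool" where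
  "exactly_two_smallest (x, y, z) \<longleftrightarrow>
     (x = y \<and> x < z) \<or> (y = z \<and> y < x) \<or> (z = x \<and> z < y)"

inductive_set euclid_closure :: "real set \<Rightarrow> real set" for X :: "real set" where
  base: "x \<in> X \<Longrightarrow> x \<in> euclid_closure X"
| add: "x \<in> euclid_closure X \<Longrightarrow> y \<in> euclid_closure X \<Longrightarrow> x + y \<in> euclid_closure X"
| sub: "x \<in> euclid_closure X \<Longrightarrow> y \<in> euclid_closure X \<Longrightarrow> x - y \<in> euclid_closure X"
| mult: "x \<in> euclid_closure X \<Longrightarrow> y \<in> euclid_closure X \<Longrightarrow> x * y \<in> euclid_closure X"
| divide: "x \<in> euclid_closure X \<Longrightarrow> y \<in> euclid_closure X \<Longrightarrow> y \<noteq> 0 \<Longrightarrow> x / y \<in> euclid_closure X"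
| sqrt: "x \<in> euclid_closure X \<Longrightarrow> x \<ge> 0 \<Longrightarrow> sqrt x \<in> euclid_closure X"

definition input_data :: "complex \<Rightarrow> complex \<Rightarrow> complex \<Rightarrow> complex \<Rightarrow> real \<Rightarrow> real set" where
  "input_data P A B C r = {Re P, Im P, Re A, Im A, Re B, Im B, Re C, Im C, r}"

end

theory Submission
  imports Defs
begin

text \<open>
  Let \<open>M\<close> be the neighbour on the common ray of the two smallest angles and \<open>X\<close>, \<open>Y\<close> the others.
  Moving the vertex towards \<open>M\<close> increases both of these angles, so at the optimum this move must
  leave the disk: the optimum lies on the boundary circle and \<open>M\<close> lies outside the disk.
  It also lies on the curve where \<open>(M - Q)\<^sup>2 / ((X - Q)(Y - Q))\<close> is real. This curve has degree
  three, but the cubic part is a linear form times \<open>\<bar>Q - P\<bar>\<^sup>2\<close>, so on the circle it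
  becomes a conic, and the rational parametrization of the circle gives a quartic. The quartic is not
  identically zero because \<open>M\<close> is off the circle.
\<close>

subsection \<open>Angles seen from a point\<close>

lemma vertex_angle_commute: "vertex_angle X Q Y = vertex_angle Y Q X"
  by (simp add: vertex_angle_def inner_commute mult.commute)

text \<open>Cauchy-Schwarz; if a vector is zero, the quotient is 0 by the convention for
  division.\<close>

lemma cos_between: "\<bar>(x \<bullet> y) / (norm x * norm y)\<bar> \<le> 1" for x y :: complex
proof (cases "norm x * norm y = 0")
  case False
  then have "norm x * norm y > 0" by (simp add: zero_less_mult_iff)
  then show ?thesis using Cauchy_Schwarz_ineq2[of x y]
    by (simp add: abs_divide abs_mult)
qed auto

lemma vertex_angle_less_iff:
  "vertex_angle X Q Y < vertex_angle X' Q' Y' \<longleftrightarrow>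
     ((X' - Q') \<bullet> (Y' - Q')) / (norm (X' - Q') * norm (Y' - Q'))
       < ((X - Q) \<bullet> (Y - Q)) / (norm (X - Q) * norm (Y - Q))"
  unfolding vertex_angle_def
  by (intro arccos_less_mono cos_between)

lemma complex_inner_eq_Re: "x \<bullet> y = Re (x * cnj y)" for x y :: complex
  by (simp add: inner_complex_def)

text \<open>Exterior angle theorem in the triangle formed by \<open>X\<close>, \<open>Q\<close> and
  the moved vertex. In terms of cosines the claim is
  \<open>(w \<bullet> v) * norm u < (u \<bullet> v) * norm w\<close>; it follows from the triangle
  inequality and strict Cauchy-Schwarz.\<close>

lemma vertex_angle_less_toward:
  fixes Q X M :: complex
  assumes nc: "Im ((X - Q) * cnj (M - Q)) \<noteq> 0" and e: "0 < e" "e < 1"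
  shows "vertex_angle X Q M < vertex_angle X (Q + e *\<^sub>R (M - Q)) M"
proof -
  define u v w where "u = X - Q" and "v = M - Q" and "w = u - e *\<^sub>R v"
  have X: "X - (Q + e *\<^sub>R (M - Q)) = w" and M: "M - (Q + e *\<^sub>R (M - Q)) = (1 - e) *\<^sub>R v"
    by (auto simp: u_def v_def w_def algebra_simps)
  have "Im (w * cnj v) = Im (u * cnj v)"
    by (simp add: w_def algebra_simps)
  with nc have im: "Im (w * cnj v) \<noteq> 0" "Im (u * cnj v) \<noteq> 0" by (auto simp: u_def v_def)
  then have pos: "norm u > 0" "norm v > 0" "norm w > 0" by auto
  \<comment> \<open>\<open>w\<close> and \<open>v\<close> are not parallel: the squared modulus of
    \<open>w * cnj v\<close> exceeds the square of \<open>w \<bullet> v\<close> by a nonzero squared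
    imaginary part.\<close>
  have cs: "\<bar>w \<bullet> v\<bar> < norm w * norm v"
  proof -
    have "(w \<bullet> v)\<^sup>2 < (cmod (w * cnj v))\<^sup>2"
      unfolding complex_inner_eq_Re cmod_power2 using im(1) zero_less_power2 by force
    then show ?thesis
      using power2_less_imp_less[of "\<bar>w \<bullet> v\<bar>" "cmod (w * cnj v)"] by (simp add: norm_mult)
  qed
  have diff: "\<bar>norm w - norm u\<bar> \<le> e * norm v"
    using norm_triangle_ineq3[of w u] e by (simp add: w_def)
  have "\<bar>(w \<bullet> v) * (norm w - norm u)\<bar> \<le> \<bar>w \<bullet> v\<bar> * (e * norm v)"
    unfolding abs_mult by (intro mult_left_mono diff) auto
  also have "\<dots> < (norm w * norm v) * (e * norm v)"
    using cs pos e by (intro mult_strict_right_mono) auto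
  finally have "(w \<bullet> v) * (norm w - norm u) + e * (norm v)\<^sup>2 * norm w > 0"
    by (simp add: power2_eq_square algebra_simps abs_less_iff)
  moreover have "u \<bullet> v = w \<bullet> v + e * (norm v)\<^sup>2"
    by (simp add: w_def inner_diff_left power2_norm_eq_inner)
  ultimately have "(w \<bullet> v) * norm u < (u \<bullet> v) * norm w"
    by (simp add: algebra_simps)
  then have "(w \<bullet> v) / (norm w * norm v) < (u \<bullet> v) / (norm u * norm v)"
    using pos by (simp add: field_simps)
  then show ?thesis
    unfolding vertex_angle_less_iff X M using e pos
    by (simp add: u_def v_def)
qed

lemma eventually_vertex_angle_toward:
  fixes Q X Y M :: complex
  assumes "X \<noteq> Q" "Y \<noteq> Q" and "vertex_angle X' Q Y' < vertex_angle X Q Y"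
  shows "\<forall>\<^sub>F e in at_right 0. vertex_angle X' Q Y' < vertex_angle X (Q + e *\<^sub>R (M - Q)) Y"
proof -
  let ?q = "\<lambda>e. Q + e *\<^sub>R (M - Q)"
  let ?c = "\<lambda>e. ((X - ?q e) \<bullet> (Y - ?q e)) / (norm (X - ?q e) * norm (Y - ?q e))"
  have "isCont ?c 0"
    using assms by (intro continuous_intros) auto
  then have "(?c \<longlongrightarrow> ?c 0) (at_right 0)"
    using isCont_def filterlim_at_split by blast
  moreover have "?c 0 < ((X' - Q) \<bullet> (Y' - Q)) / (norm (X' - Q) * norm (Y' - Q))"
    using assms(3) unfolding vertex_angle_less_iff by simp
  ultimately show ?thesis
    unfolding vertex_angle_less_iff by (rule order_tendstoD(2))
qed

text \<open>The two equal angles at \<open>M\<close> grow, and the third, being strictly larger at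
  \<open>Q\<close>, stays above their old value by continuity.\<close>

lemma min_angle_increases_toward_middle:
  fixes Q X M Y :: complex
  assumes nX: "Im ((X - Q) * cnj (M - Q)) \<noteq> 0" and nY: "Im ((Y - Q) * cnj (M - Q)) \<noteq> 0"
    and eq: "vertex_angle X Q M = vertex_angle Y Q M"
    and less: "vertex_angle X Q M < vertex_angle X Q Y"
  shows "\<forall>\<^sub>F e in at_right 0. Q + e *\<^sub>R (M - Q) \<notin> {X, M, Y} \<and>
           min_angle Q X M Y < min_angle (Q + e *\<^sub>R (M - Q)) X M Y"
proof -
  have "X \<noteq> Q" "Y \<noteq> Q" "M \<noteq> Q" using nX nY by auto
  then have "\<forall>\<^sub>F e in at_right 0. vertex_angle X Q M < vertex_angle X (Q + e *\<^sub>R (M - Q)) Y"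
    using less by (intro eventually_vertex_angle_toward)
  moreover have "\<forall>\<^sub>F e in at_right (0::real). e \<in> {0<..<1}"
    by (rule eventually_at_right_real) simp
  ultimately show ?thesis
  proof eventually_elim
    case (elim e)
    let ?q = "Q + e *\<^sub>R (M - Q)"
    \<comment> \<open>A shift along \<open>M - Q\<close> does not change these imaginary parts, so
      the moved vertex avoids \<open>X\<close> and \<open>Y\<close>.\<close>
    have "Im ((X - ?q) * cnj (M - Q)) \<noteq> 0" "Im ((Y - ?q) * cnj (M - Q)) \<noteq> 0"
      using nX nY by (simp_all add: algebra_simps)
    then have "?q \<noteq> X" "?q \<noteq> Y" by (metis diff_self mult_zero_left zero_complex.sel(2))+
    moreover have "?q \<noteq> M"
    proof
      assume "?q = M"
      then have "e *\<^sub>R (M - Q) = 1 *\<^sub>R (M - Q)" by (simp add: eq_diff_eq add.commute)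
      then show False using elim \<open>M \<noteq> Q\<close> by (simp only: scaleR_cancel_right) auto
    qed
    moreover have "vertex_angle X Q M < vertex_angle X ?q M"
      "vertex_angle Y Q M < vertex_angle Y ?q M"
      using elim nX nY by (auto intro!: vertex_angle_less_toward)
    ultimately show ?case
      using elim eq unfolding min_angle_def
      by (auto simp: vertex_angle_commute[of M _ Y] vertex_angle_commute[of Y _ X] min_def)
  qed
qed

text \<open>By optimality, small moves towards \<open>M\<close> must leave the disk. They would stay
  inside by continuity if \<open>Q\<close> were interior, and by convexity if \<open>M\<close> were
  in the disk.\<close>

lemma optimum_on_circle:
  fixes Q X M Y P :: complex
  assumes "Im ((X - Q) * cnj (M - Q)) \<noteq> 0" and "Im ((Y - Q) * cnj (M - Q)) \<noteq> 0"
    and "vertex_angle X Q M = vertex_angle Y Q M"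
    and "vertex_angle X Q M < vertex_angle X Q Y"
    and Q: "Q \<in> cball P r"
    and opt: "\<forall>Q' \<in> cball P r - {X, M, Y}. min_angle Q' X M Y \<le> min_angle Q X M Y"
  shows "norm (Q - P) = r" and "r < norm (M - P)"
proof -
  let ?q = "\<lambda>e. Q + e *\<^sub>R (M - Q)"
  have ev: "\<forall>\<^sub>F e in at_right 0. ?q e \<notin> cball P r"
    using min_angle_increases_toward_middle[OF assms(1-4)]
    by (rule eventually_mono) (use opt in force)
  have False if "\<forall>\<^sub>F e in at_right 0. ?q e \<in> cball P r"
    using eventually_happens'[OF _ eventually_conj[OF ev that]] by simp
  moreover have "\<forall>\<^sub>F e in at_right 0. ?q e \<in> cball P r" if "norm (Q - P) < r"
  proof -
    have "((\<lambda>e. norm (?q e - P)) \<longlongrightarrow> norm (?q 0 - P)) (at_right 0)"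
      by (intro tendsto_intros)
    then have "\<forall>\<^sub>F e in at_right 0. norm (?q e - P) < r"
      using that by (intro order_tendstoD(2)) auto
    then show ?thesis
      by (rule eventually_mono) (simp add: dist_norm norm_minus_commute)
  qed
  moreover have "\<forall>\<^sub>F e in at_right 0. ?q e \<in> cball P r" if "norm (M - P) \<le> r"
  proof -
    have "\<forall>\<^sub>F e in at_right (0::real). e \<in> {0<..<1}"
      by (rule eventually_at_right_real) simp
    then show ?thesis
    proof eventually_elim
      case (elim e)
      have "(1 - e) *\<^sub>R Q + e *\<^sub>R M \<in> cball P r"
        using convex_cball[of P r] elim Q that
        by (intro convexD) (auto simp: dist_norm norm_minus_commute)
      then show ?case by (simp add: algebra_simps)
    qed
  qed
  ultimately show "norm (Q - P) = r" "r < norm (M - P)"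
    using Q by (force simp: dist_norm norm_minus_commute)+
qed

subsection \<open>Counterclockwise angles\<close>

lemma ccw_angle_bounds: "0 \<le> ccw_angle Q X Y" "ccw_angle Q X Y < 2 * pi"
  using Arg_bounded[of "(Y - Q) / (X - Q)"] pi_gt_zero
  by (auto simp: ccw_angle_def Let_def simp del: pi_gt_zero)

lemma cis_ccw_angle:
  assumes "X \<noteq> Q" "Y \<noteq> Q"
  shows "(Y - Q) / (X - Q) = norm ((Y - Q) / (X - Q)) * cis (ccw_angle Q X Y)"
proof -
  have "cis (ccw_angle Q X Y) = cis (Arg ((Y - Q) / (X - Q)))"
    by (simp add: ccw_angle_def Let_def flip: cis_mult)
  then show ?thesis
    using assms by (simp add: cis_Arg sgn_eq)
qed

lemma cis_ccw_angle_sgn: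
  assumes "X \<noteq> Q" "Y \<noteq> Q"
  shows "cis (ccw_angle Q X Y) = sgn (Y - Q) / sgn (X - Q)"
  using cis_ccw_angle[OF assms] assms
  by (simp add: sgn_eq norm_divide field_simps)

text \<open>The normalized inner product is the cosine of the counterclockwise angle;
  \<open>arccos\<close> folds a reflex angle \<open>t\<close> to \<open>2 * pi - t\<close>.\<close>

lemma vertex_angle_eq_arccos_cos_ccw:
  assumes "X \<noteq> Q" "Y \<noteq> Q"
  shows "vertex_angle X Q Y = arccos (cos (ccw_angle Q X Y))"
proof -
  have "cos (ccw_angle Q X Y) = Re ((Y - Q) / (X - Q)) / norm ((Y - Q) / (X - Q))"
    using arg_cong[OF cis_ccw_angle[OF assms], of Re] assms by (simp add: field_simps)
  also have "\<dots> = ((X - Q) \<bullet> (Y - Q)) / (norm (X - Q) * norm (Y - Q))"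
    using assms
    by (simp add: Re_divide' norm_divide inner_complex_def field_simps power2_eq_square)
  finally show ?thesis by (simp add: vertex_angle_def)
qed

lemma cis_eq_1E:
  assumes "cis t = 1"
  obtains n :: int where "t = 2 * pi * n"
proof -
  have "cos t = 1" using assms by (simp add: complex_eq_iff)
  then show ?thesis using that cos_one_2pi_int[of t] by (auto simp: mult_ac)
qed

lemma ccw_angle_swap:
  assumes "X \<noteq> Q" "Y \<noteq> Q"
  shows "ccw_angle Q Y X = (if ccw_angle Q X Y = 0 then 0 else 2 * pi - ccw_angle Q X Y)"
proof -
  have "cis (ccw_angle Q X Y + ccw_angle Q Y X) = 1"
    using assms by (simp add: cis_ccw_angle_sgn sgn_zero_iff flip: cis_mult)
  then obtain n :: int where n: "ccw_angle Q X Y + ccw_angle Q Y X = 2 * pi * n"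
    by (rule cis_eq_1E)
  have "0 \<le> 2 * pi * n" "2 * pi * n < 2 * pi * 2"
    using n ccw_angle_bounds[of Q X Y] ccw_angle_bounds[of Q Y X] by linarith+
  then have "n = 0 \<or> n = 1"
    using pi_gt_zero by (auto simp: zero_le_mult_iff simp del: pi_gt_zero)
  then show ?thesis
    using n ccw_angle_bounds[of Q X Y] ccw_angle_bounds[of Q Y X] by auto
qed

text \<open>The unit directions telescope, so the sum is a multiple of \<open>2 * pi\<close>, and it
  is less than \<open>6 * pi\<close>. The value 0 means that all rays coincide,
  \<open>2 * pi\<close> the cyclic order X, Y, Z, and \<open>4 * pi\<close> the reverse
  order.\<close>

lemma ccw_angle_sum:
  assumes "X \<noteq> Q" "Y \<noteq> Q" "Z \<noteq> Q"
  shows "ccw_angle Q X Y + ccw_angle Q Y Z + ccw_angle Q Z X \<in> {0, 2 * pi, 4 * pi}"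
proof -
  let ?s = "ccw_angle Q X Y + ccw_angle Q Y Z + ccw_angle Q Z X"
  have "cis ?s = 1"
    using assms by (simp add: cis_ccw_angle_sgn sgn_zero_iff flip: cis_mult)
  then obtain n :: int where n: "?s = 2 * pi * n"
    by (rule cis_eq_1E)
  have "0 \<le> 2 * pi * n" "2 * pi * n < 2 * pi * 3"
    using n ccw_angle_bounds[of Q X Y] ccw_angle_bounds[of Q Y Z] ccw_angle_bounds[of Q Z X]
    by linarith+
  then have "n = 0 \<or> n = 1 \<or> n = 2"
    using pi_gt_zero by (auto simp: zero_le_mult_iff simp del: pi_gt_zero)
  then show ?thesis using n by auto
qed

text \<open>Only the sum 0 has to be excluded, and there all angles vanish. From the sum
  \<open>4 * pi\<close>, reversing the order replaces each angle by its complement to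
  \<open>2 * pi\<close>, and the new sum is \<open>6 * pi - 4 * pi\<close>.\<close>

lemma consecutive_angles_cases:
  assumes "A \<noteq> Q" "B \<noteq> Q" "C \<noteq> Q" and "exactly_two_smallest (consecutive_angles Q A B C)"
  obtains X Y Z where "(X, Y, Z) \<in> {(A, B, C), (A, C, B)}"
    and "consecutive_angles Q A B C = (ccw_angle Q X Y, ccw_angle Q Y Z, ccw_angle Q Z X)"
    and "ccw_angle Q X Y + ccw_angle Q Y Z + ccw_angle Q Z X = 2 * pi"
proof (cases "ccw_angle Q A B + ccw_angle Q B C + ccw_angle Q C A = 2 * pi")
  case True
  then show ?thesis by (intro that[of A B C]) (auto simp: consecutive_angles_def)
next
  case False
  have bnd: "0 \<le> ccw_angle Q S T" "ccw_angle Q S T < 2 * pi" for S T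
    by (rule ccw_angle_bounds)+
  have "ccw_angle Q A B + ccw_angle Q B C + ccw_angle Q C A \<in> {0, 4 * pi}"
    using ccw_angle_sum[of A Q B C] assms False by auto
  \<comment> \<open>With the sum \<open>4 * pi\<close> no angle is 0, since the other two are each
    below \<open>2 * pi\<close>.\<close>
  then consider "ccw_angle Q A B = 0" "ccw_angle Q B C = 0" "ccw_angle Q C A = 0"
    | "ccw_angle Q A B + ccw_angle Q B C + ccw_angle Q C A = 4 * pi"
      "ccw_angle Q A B \<noteq> 0" "ccw_angle Q B C \<noteq> 0" "ccw_angle Q C A \<noteq> 0"
    using bnd[of A B] bnd[of B C] bnd[of C A] by (auto simp: add_nonneg_eq_0_iff)
  then show ?thesis
  proof cases
    case 1
    then show ?thesis
      using assms False ccw_angle_swap[of A Q B] ccw_angle_swap[of B Q C] ccw_angle_swap[of C Q A]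
      by (auto simp: consecutive_angles_def)
  next
    case 2
    then show ?thesis
      using assms False ccw_angle_swap[of A Q B] ccw_angle_swap[of B Q C] ccw_angle_swap[of C Q A]
      by (intro that[of A C B]) (auto simp: consecutive_angles_def)
  qed
qed

text \<open>A cyclic rotation puts the two equal angles first, and \<open>M\<close> is the neighbour
  they share. The third angle is less than \<open>2 * pi\<close> and greater than
  \<open>\<theta>\<close>, which gives the two bounds on \<open>\<theta>\<close>.\<close>

lemma exactly_two_smallest_middle:
  assumes "A \<noteq> Q" "B \<noteq> Q" "C \<noteq> Q" and "exactly_two_smallest (consecutive_angles Q A B C)"
  obtains X M Y \<theta> where
    "(X, M, Y) \<in> {(A, B, C), (B, C, A), (C, A, B), (A, C, B), (C, B, A), (B, A, C)}"
    "ccw_angle Q X M = \<theta>" "ccw_angle Q M Y = \<theta>" "ccw_angle Q Y X = 2 * pi - 2 * \<theta>"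
    "0 < \<theta>" "3 * \<theta> < 2 * pi"
proof -
  obtain X Y Z where XYZ: "(X, Y, Z) \<in> {(A, B, C), (A, C, B)}"
    and c: "consecutive_angles Q A B C = (ccw_angle Q X Y, ccw_angle Q Y Z, ccw_angle Q Z X)"
    and s: "ccw_angle Q X Y + ccw_angle Q Y Z + ccw_angle Q Z X = 2 * pi"
    using consecutive_angles_cases[OF assms] .
  have bnd: "0 \<le> ccw_angle Q S T" "ccw_angle Q S T < 2 * pi" for S T
    by (rule ccw_angle_bounds)+
  note b = bnd[of X Y] bnd[of Y Z] bnd[of Z X]
  consider "ccw_angle Q X Y = ccw_angle Q Y Z" "ccw_angle Q X Y < ccw_angle Q Z X"
    | "ccw_angle Q Y Z = ccw_angle Q Z X" "ccw_angle Q Y Z < ccw_angle Q X Y"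
    | "ccw_angle Q Z X = ccw_angle Q X Y" "ccw_angle Q Z X < ccw_angle Q Y Z"
    using assms(4) unfolding c by auto
  then show ?thesis
  proof cases
    case 1
    show ?thesis by (rule that[of X Y Z "ccw_angle Q X Y"]) (use 1 XYZ s b in auto)
  next
    case 2
    show ?thesis by (rule that[of Y Z X "ccw_angle Q Y Z"]) (use 2 XYZ s b in auto)
  next
    case 3
    show ?thesis by (rule that[of Z X Y "ccw_angle Q Z X"]) (use 3 XYZ s b in auto)
  qed
qed

lemma min_angle_permute:
  assumes "(X, M, Y) \<in> {(A, B, C), (B, C, A), (C, A, B), (A, C, B), (C, B, A), (B, A, C)}"
  shows "min_angle Q X M Y = min_angle Q A B C"
  using assms
  by (auto simp: min_angle_def vertex_angle_commute[of B Q A] vertex_angle_commute[of C Q B]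
      vertex_angle_commute[of A Q C] min.commute min.left_commute)

subsection \<open>The quartic\<close>

lemma zero_in_euclid_closure: "x \<in> euclid_closure S \<Longrightarrow> 0 \<in> euclid_closure S"
  using euclid_closure.sub[of x S x] by simp

text \<open>\<open>euclid_closure\<close> has no rule for constants; in the applications the radius
  \<open>r\<close> is the nonzero element that yields 1.\<close>

lemma one_in_euclid_closure: "x \<in> euclid_closure S \<Longrightarrow> x \<noteq> 0 \<Longrightarrow> 1 \<in> euclid_closure S"
  using euclid_closure.divide[of x S x] by simp

definition complex_over :: "real set \<Rightarrow> complex set" where
  "complex_over E = {z. Re z \<in> E \<and> Im z \<in> E}"

lemma coeff_mult_complex_over:
  assumes "\<And>i. coeff p i \<in> complex_over (euclid_closure S)"
    and "\<And>i. coeff q i \<in> complex_over (euclid_closure S)"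
  shows "coeff (p * q) i \<in> complex_over (euclid_closure S)"
proof -
  have *: "(\<Sum>j\<in>J. coeff p j * coeff q (i - j)) \<in> complex_over (euclid_closure S)" if "finite J" for J
    using that
  proof induction
    case empty
    then show ?case using assms(1)[of 0] by (auto simp: complex_over_def intro: zero_in_euclid_closure)
  next
    case (insert j J)
    then show ?case using assms(1)[of j] assms(2)[of "i - j"]
      by (simp add: complex_over_def euclid_closure.intros)
  qed
  show ?thesis unfolding coeff_mult by (rule *) simp
qed

lemma coeff_linear_complex_over:
  assumes "x \<in> complex_over (euclid_closure S)" "y \<in> complex_over (euclid_closure S)"
  shows "coeff [:x, y:] i \<in> complex_over (euclid_closure S)"
  using assms by (auto simp: coeff_pCons complex_over_def zero_in_euclid_closure split: nat.split)

text \<open>For \<open>q = r(1 + it)/(1 - it)\<close> with real \<open>t\<close>, the value at \<open>t\<close> is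
  \<open>(1 + t\<^sup>2)\<^sup>2 (m - q)\<^sup>2 cnj ((x - q)(y - q))\<close>.\<close>
definition bisector_poly :: "real \<Rightarrow> complex \<Rightarrow> complex \<Rightarrow> complex \<Rightarrow> complex poly" where
  "bisector_poly r x m y =
     [:m - r, - \<i> * (m + r):] * [:m - r, - \<i> * (m + r):] *
     ([:cnj x - r, \<i> * (cnj x + r):] * [:cnj y - r, \<i> * (cnj y + r):])"

text \<open>At real \<open>z\<close>, with \<open>q\<close> the point of parameter \<open>z\<close>,
  the squared factor is \<open>(1 - \<i> * z) * (m - q)\<close> and the others are
  \<open>1 + \<i> * z\<close> times the conjugates of \<open>x - q\<close> and
  \<open>y - q\<close>.\<close>

lemma poly_bisector_poly:
  "poly (bisector_poly r x m y) z =
     (m * (1 - \<i> * z) - r * (1 + \<i> * z))\<^sup>2 *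
     ((cnj x * (1 + \<i> * z) - r * (1 - \<i> * z)) * (cnj y * (1 + \<i> * z) - r * (1 - \<i> * z)))"
  by (simp add: bisector_poly_def power2_eq_square algebra_simps)

lemma degree_bisector_poly: "degree (bisector_poly r x m y) \<le> 4"
proof -
  have "degree [:a, b:] \<le> 1" for a b :: complex
    by (simp add: degree_pCons_eq_if)
  then have "degree ([:a, b:] * [:c, d:]) \<le> 2" for a b c d :: complex
    using add_mono order.trans[OF degree_mult_le] by (metis one_add_one)
  then show ?thesis
    unfolding bisector_poly_def using add_mono order.trans[OF degree_mult_le]
    by (metis numeral_Bit0)
qed

lemma coeff_bisector_poly:
  assumes "r \<in> euclid_closure S" and "x \<in> complex_over (euclid_closure S)"
    "m \<in> complex_over (euclid_closure S)" "y \<in> complex_over (euclid_closure S)"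
  shows "coeff (bisector_poly r x m y) i \<in> complex_over (euclid_closure S)"
proof -
  have [simp]: "0 \<in> euclid_closure S" using assms(1) by (rule zero_in_euclid_closure)
  have [simp]: "- a \<in> euclid_closure S" if "a \<in> euclid_closure S" for a
    using euclid_closure.sub[of 0 S a] that by simp
  have "- a - b \<in> euclid_closure S" if "a \<in> euclid_closure S" "b \<in> euclid_closure S" for a b
    using euclid_closure.sub[of "- a" S b] that by simp
  then show ?thesis
    unfolding bisector_poly_def using assms
    by (intro coeff_mult_complex_over coeff_linear_complex_over)
      (auto simp: complex_over_def intro!: euclid_closure.add euclid_closure.sub)
qed

text \<open>Powers of a real \<open>t\<close> are real, so imaginary parts may be taken
  coefficientwise. This turns the complex quartic into a real one.\<close>

lemma poly_map_poly_Im: "poly (map_poly Im p) t = Im (poly p (of_real t))"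
  by (induction p) (auto simp: map_poly_pCons)

text \<open>A real polynomial vanishes at conjugate points; the zero \<open>t\<close> with
  \<open>m = r(1 + it)/(1 - it)\<close> has a conjugate that is not a zero when \<open>m\<close> is off the circle.\<close>
lemma Im_bisector_poly_nonzero:
  assumes "r > 0" "norm m \<noteq> r" "x \<noteq> m" "y \<noteq> m"
  shows "map_poly Im (bisector_poly r x m y) \<noteq> 0"
proof
  let ?p = "bisector_poly r x m y"
  assume 0: "map_poly Im ?p = 0"
  have "Im (coeff ?p i) = 0" for i
    using arg_cong[OF 0, of "\<lambda>q. coeff q i"] by (simp add: coeff_map_poly)
  then have real: "cnj (coeff ?p i) = coeff ?p i" for i
    by (simp add: complex_eq_iff)
  have cnj: "poly ?p (cnj z) = cnj (poly ?p z)" for z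
    by (simp add: poly_altdef real)
  have mr: "m + r \<noteq> 0" "cnj m + r \<noteq> 0"
  proof -
    show "m + r \<noteq> 0"
      using assms(1,2) by (metis abs_of_pos add_eq_0_iff2 norm_minus_cancel norm_of_real)
    then show "cnj m + r \<noteq> 0"
      by (metis complex_cnj_add complex_cnj_complex_of_real complex_cnj_zero_iff)
  qed
  define t where "t = - \<i> * (m - r) / (m + r)"
  have p1: "1 + \<i> * t = 2 * m / (m + r)" and m1: "1 - \<i> * t = 2 * r / (m + r)"
    using mr by (simp_all add: t_def field_simps)
  have p2: "1 + \<i> * cnj t = 2 * r / (cnj m + r)" and m2: "1 - \<i> * cnj t = 2 * cnj m / (cnj m + r)"
    using arg_cong[OF m1, of cnj] arg_cong[OF p1, of cnj] by simp_all
  have "poly ?p t = 0" unfolding poly_bisector_poly p1 m1 by simp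
  then have "poly ?p (cnj t) = 0" using cnj by simp
  then have "m * (2 * cnj m / (cnj m + r)) = r * (2 * r / (cnj m + r)) \<or>
      cnj x * (2 * r / (cnj m + r)) = r * (2 * cnj m / (cnj m + r)) \<or>
      cnj y * (2 * r / (cnj m + r)) = r * (2 * cnj m / (cnj m + r))"
    unfolding poly_bisector_poly p2 m2 by auto
  then have "m * cnj m = of_real (r * r) \<or> cnj x = cnj m \<or> cnj y = cnj m"
    using mr assms(1) by (auto simp: field_simps)
  then have "of_real ((norm m)\<^sup>2) = (of_real (r\<^sup>2) :: complex)"
    using assms(3,4) unfolding complex_norm_square by (simp add: power2_eq_square)
  then have "(norm m)\<^sup>2 = r\<^sup>2" by (simp only: of_real_eq_iff)
  then show False using assms(1,2) by (simp add: power2_eq_iff_nonneg)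
qed

text \<open>The hypothesis \<open>bis\<close> says that \<open>Q\<close> lies on the curve;
  multiplied by the real factor \<open>(1 + t * t)\<^sup>2\<close>, it becomes a polynomial equation
  for the parameter \<open>t\<close> of \<open>Q\<close>.\<close>

lemma circle_point_quartic:
  fixes P Q X M Y :: complex and r :: real and S :: "real set"
  assumes r: "r > 0" and Q: "norm (Q - P) = r" and M: "norm (M - P) \<noteq> r"
    and "X \<noteq> M" "Y \<noteq> M"
    and bis: "Im ((M - Q)\<^sup>2 * cnj ((X - Q) * (Y - Q))) = 0"
    and S: "r \<in> S" "{P, X, M, Y} \<subseteq> complex_over S"
  shows "\<exists>p :: real poly. p \<noteq> 0 \<and> degree p \<le> 4 \<and> (\<forall>i. coeff p i \<in> euclid_closure S) \<and>
           (\<exists>t. poly p t = 0 \<and> Re Q \<in> euclid_closure (insert t S) \<and>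
                Im Q \<in> euclid_closure (insert t S))"
proof (cases "r + Re (Q - P) = 0")
  \<comment> \<open>Here \<open>Q = P - r\<close>, the one point of the circle that the
    parametrization misses. Its coordinates come directly from the data, so the polynomial
    \<open>[:0, 1:]\<close> with root 0 serves.\<close>
  case True
  have "Im (Q - P) = 0"
  proof -
    have "(Re (Q - P))\<^sup>2 + (Im (Q - P))\<^sup>2 = r\<^sup>2" unfolding Q[symmetric] cmod_power2 by simp
    moreover have "Re (Q - P) = - r" using True by linarith
    ultimately show ?thesis by simp
  qed
  then have "Re Q = Re P - r" "Im Q = Im P" using True by auto
  then have "Re Q \<in> euclid_closure (insert 0 S)" "Im Q \<in> euclid_closure (insert 0 S)"
    using S by (simp_all add: complex_over_def euclid_closure.sub euclid_closure.base)
  moreover have "coeff [:0, 1:] i \<in> euclid_closure S" for i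
    using zero_in_euclid_closure[of r S] one_in_euclid_closure[of r S] S r
    by (auto simp: coeff_pCons euclid_closure.base split: nat.split)
  ultimately show ?thesis
    by (intro exI[of _ "[:0, 1:]"] conjI exI[of _ 0]) auto
next
  case False
  define q where "q = Q - P"
  \<comment> \<open>The tangent of half the polar angle of \<open>q\<close>.\<close>
  define t where "t = Im q / (r + Re q)"
  define p where "p = bisector_poly r (X - P) (M - P) (Y - P)"
  have nz: "r + Re q \<noteq> 0" using False by (simp add: q_def)
  have nq: "(Re q)\<^sup>2 + (Im q)\<^sup>2 = r\<^sup>2" unfolding Q[symmetric] cmod_power2 q_def by simp
  have qt: "q * (1 - \<i> * t) = r * (1 + \<i> * t)"
    using nz nq by (simp add: complex_eq_iff t_def field_simps power2_eq_square)
  have qt': "cnj q * (1 + \<i> * t) = r * (1 - \<i> * t)"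
    using arg_cong[OF qt, of cnj] by simp
  have t2: "1 + t\<^sup>2 = 2 * r / (r + Re q)"
    using nz nq unfolding t_def
    by (simp add: power_divide field_simps) algebra
  \<comment> \<open>The point is recovered rationally from \<open>t\<close>; \<open>r + r\<close>
    and \<open>t * t\<close> stand for \<open>2 * r\<close> and \<open>t\<^sup>2\<close> so that the
    closure rules apply directly.\<close>
  have Re: "Re Q = Re P + (r + r) / (1 + t * t) - r"
    using nz r t2 by (simp add: q_def power2_eq_square)
  have Im: "Im Q = Im P + (r + r) / (1 + t * t) * t"
  proof -
    have "(r + r) / (1 + t * t) * t = Im q"
      using nz r t2 by (simp add: power2_eq_square) (simp add: t_def)
    then show ?thesis by (simp add: q_def)
  qed
  have "Re P \<in> S" "Im P \<in> S" using S by (auto simp: complex_over_def)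
  then have in_closure: "r \<in> euclid_closure (insert t S)" "t \<in> euclid_closure (insert t S)"
    "Re P \<in> euclid_closure (insert t S)" "Im P \<in> euclid_closure (insert t S)"
    using S(1) by (auto intro: euclid_closure.base)
  have one: "1 \<in> euclid_closure (insert t S)"
    using in_closure(1) r by (intro one_in_euclid_closure) auto
  have nt: "1 + t * t \<noteq> 0" by (metis power2_eq_square power_one sum_power2_eq_zero_iff zero_neq_one)
  have mem: "Re Q \<in> euclid_closure (insert t S)" "Im Q \<in> euclid_closure (insert t S)"
    unfolding Re Im
    by (intro euclid_closure.sub euclid_closure.add euclid_closure.mult euclid_closure.divide
        in_closure one nt)+
  \<comment> \<open>By \<open>qt\<close> and \<open>qt'\<close>, each factor of the polynomial
    splits off \<open>1 - \<i> * t\<close> or \<open>1 + \<i> * t\<close>.\<close>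
  have "poly p (of_real t) = ((M - P) * (1 - \<i> * t) - q * (1 - \<i> * t))\<^sup>2 *
     ((cnj (X - P) * (1 + \<i> * t) - cnj q * (1 + \<i> * t)) *
      (cnj (Y - P) * (1 + \<i> * t) - cnj q * (1 + \<i> * t)))"
    unfolding p_def poly_bisector_poly qt qt' by simp
  also have "\<dots> = ((1 - \<i> * t) * (1 + \<i> * t))\<^sup>2 * ((M - Q)\<^sup>2 * cnj ((X - Q) * (Y - Q)))"
    by (simp add: q_def power2_eq_square) (simp add: algebra_simps)
  also have "(1 - \<i> * t) * (1 + \<i> * t) = of_real (1 + t * t)"
    by (simp add: algebra_simps)
  finally have "Im (poly p (of_real t)) = 0"
    using bis by (simp flip: of_real_power)
  then have root: "poly (map_poly Im p) t = 0" by (simp add: poly_map_poly_Im)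
  have "r \<in> euclid_closure S" using S by (intro euclid_closure.base)
  moreover have "Z - P \<in> complex_over (euclid_closure S)" if "Z \<in> {X, M, Y}" for Z
    using S that by (auto simp: complex_over_def intro!: euclid_closure.sub intro: euclid_closure.base)
  ultimately have "coeff p i \<in> complex_over (euclid_closure S)" for i
    unfolding p_def by (intro coeff_bisector_poly) auto
  then have coeffs: "coeff (map_poly Im p) i \<in> euclid_closure S" for i
    by (simp add: coeff_map_poly complex_over_def)
  have "degree (map_poly Im p) \<le> 4"
    using degree_bisector_poly[of r "X - P" "M - P" "Y - P"]
    by (intro degree_le) (auto simp: coeff_map_poly coeff_eq_0 simp flip: p_def)
  moreover have "map_poly Im p \<noteq> 0"
    unfolding p_def using assms by (intro Im_bisector_poly_nonzero) auto
  ultimately show ?thesis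
    using root coeffs mem by blast
qed

section \<open>The optimal position\<close>

theorem theorem1:
  fixes P A B C Pstar :: complex and r :: real
  assumes "r > 0"
    and "A \<noteq> B" and "B \<noteq> C" and "C \<noteq> A"
    and "Pstar \<in> cball P r" and "Pstar \<notin> {A, B, C}"
    and "\<forall>Q \<in> cball P r - {A, B, C}. min_angle Q A B C \<le> min_angle Pstar A B C"
    and "exactly_two_smallest (consecutive_angles Pstar A B C)"
  shows "\<exists>p :: real poly. p \<noteq> 0 \<and> degree p \<le> 4 \<and>
           (\<forall>i. coeff p i \<in> euclid_closure (input_data P A B C r)) \<and>
           (\<exists>t. poly p t = 0 \<and>
                Re Pstar \<in> euclid_closure (insert t (input_data P A B C r)) \<and>
                Im Pstar \<in> euclid_closure (insert t (input_data P A B C r)))"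
proof -
  let ?Q = Pstar
  obtain X M Y \<theta> where
    perm: "(X, M, Y) \<in> {(A, B, C), (B, C, A), (C, A, B), (A, C, B), (C, B, A), (B, A, C)}"
    and ccw: "ccw_angle ?Q X M = \<theta>" "ccw_angle ?Q M Y = \<theta>" "ccw_angle ?Q Y X = 2 * pi - 2 * \<theta>"
    and \<theta>: "0 < \<theta>" "3 * \<theta> < 2 * pi"
    by (rule exactly_two_smallest_middle[of A ?Q B C]) (use assms in blast)+
  have set: "{X, M, Y} = {A, B, C}" using perm by auto
  have ne: "X \<noteq> ?Q" "M \<noteq> ?Q" "Y \<noteq> ?Q" and dist: "X \<noteq> M" "Y \<noteq> M"
    using perm assms by auto
  define u v w where "u = X - ?Q" and "v = M - ?Q" and "w = Y - ?Q"
  have nz: "u \<noteq> 0" "v \<noteq> 0" "w \<noteq> 0" using ne by (auto simp: u_def v_def w_def)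
  \<comment> \<open>Both turns, from \<open>u\<close> to \<open>v\<close> and from \<open>v\<close>
    to \<open>w\<close>, are by \<open>\<theta>\<close>; only the length ratios \<open>a\<close> and
    \<open>b\<close> differ.\<close>
  define a b where "a = norm (v / u)" and "b = norm (w / v)"
  have ab: "a > 0" "b > 0" using nz by (auto simp: a_def b_def)
  have v: "v = a * cis \<theta> * u" and w: "w = b * cis \<theta> * v"
    using cis_ccw_angle[of X ?Q M] cis_ccw_angle[of M ?Q Y] ne nz ccw
    by (auto simp: a_def b_def u_def v_def w_def field_simps)
  have uu: "z * cnj z = of_real ((norm z)\<^sup>2)" for z
    by (rule complex_norm_square[symmetric])
  have "u * cnj v = of_real (a * (norm u)\<^sup>2) * cnj (cis \<theta>)"
    unfolding v using uu[of u] by (simp add: mult_ac)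
  moreover have "w * cnj v = of_real (b * (norm v)\<^sup>2) * cis \<theta>"
    unfolding w using uu[of v] by (simp add: mult_ac)
  \<comment> \<open>The bound \<open>3 * \<theta> < 2 * pi\<close> keeps \<open>\<theta>\<close>
    below \<open>pi\<close>, so neither \<open>X\<close> nor \<open>Y\<close> is collinear with
    \<open>?Q\<close> and \<open>M\<close>.\<close>
  moreover have "sin \<theta> > 0" using \<theta> by (intro sin_gt_zero) auto
  ultimately have im: "Im (u * cnj v) \<noteq> 0" "Im (w * cnj v) \<noteq> 0" using nz ab by auto
  have va: "vertex_angle X ?Q M = \<theta>" "vertex_angle Y ?Q M = \<theta>"
    using ccw \<theta> ne vertex_angle_commute[of Y ?Q M]
    by (simp_all add: vertex_angle_eq_arccos_cos_ccw arccos_cos)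
  \<comment> \<open>The non-reflex third angle is \<open>2 * \<theta>\<close> or
    \<open>2 * pi - 2 * \<theta>\<close>, whichever is at most \<open>pi\<close>; the second exceeds
    \<open>\<theta>\<close> because \<open>3 * \<theta> < 2 * pi\<close>.\<close>
  have "\<theta> < vertex_angle Y ?Q X"
  proof (cases "2 * \<theta> \<le> pi")
    case True
    have "cos (2 * pi - 2 * \<theta>) = cos (2 * \<theta>)" by (simp add: cos_diff)
    then show ?thesis
      using True ccw \<theta> ne arccos_cos[of "2 * \<theta>"] by (simp add: vertex_angle_eq_arccos_cos_ccw)
  next
    case False
    then have "arccos (cos (2 * pi - 2 * \<theta>)) = 2 * pi - 2 * \<theta>"
      using \<theta> by (intro arccos_cos) auto
    then show ?thesis
      unfolding vertex_angle_eq_arccos_cos_ccw[OF ne(3,1)] ccw(3) using \<theta> by linarith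
  qed
  then have third: "vertex_angle X ?Q M < vertex_angle X ?Q Y"
    using va vertex_angle_commute[of X ?Q Y] by simp
  have opt: "\<forall>Q' \<in> cball P r - {X, M, Y}. min_angle Q' X M Y \<le> min_angle ?Q X M Y"
    unfolding set using assms(7) min_angle_permute[OF perm] by simp
  have circle: "norm (?Q - P) = r" "r < norm (M - P)"
    using optimum_on_circle[of X ?Q M Y P r] im va third opt assms(5)
    by (simp_all add: u_def v_def w_def)
  \<comment> \<open>The rotation by \<open>\<theta>\<close> from \<open>u\<close> to
    \<open>v\<close> cancels against the conjugate of the one from \<open>v\<close> to
    \<open>w\<close>, so a real number remains.\<close>
  have "v\<^sup>2 * cnj (u * w) = (v * cnj v) * (v * cnj u) * (b * cnj (cis \<theta>))"
    unfolding w by (simp add: power2_eq_square mult_ac)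
  also have "v * cnj u = of_real (a * (norm u)\<^sup>2) * cis \<theta>"
    unfolding v using uu[of u] by (simp add: mult_ac)
  also have "(v * cnj v) * (of_real (a * (norm u)\<^sup>2) * cis \<theta>) * (b * cnj (cis \<theta>)) =
      of_real ((norm v)\<^sup>2 * (a * (norm u)\<^sup>2) * b)"
    unfolding uu by (simp add: cis_cnj mult_ac cis_mult)
  finally have bis: "Im ((M - ?Q)\<^sup>2 * cnj ((X - ?Q) * (Y - ?Q))) = 0"
    by (simp only: u_def v_def w_def Im_complex_of_real)
  show ?thesis
  proof (rule circle_point_quartic)
    show "{P, X, M, Y} \<subseteq> complex_over (input_data P A B C r)"
      unfolding insert_subset set using perm
      by (auto simp: complex_over_def input_data_def)
    show "r \<in> input_data P A B C r" by (simp add: input_data_def)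
  qed (use assms(1) circle dist bis in auto)
qed

end
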